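(* Let $\varepsilon=2$ and let $f_\varepsilon:\mathbb{T}^2\to\mathbb{T}^2$, $\mathbb{T}^2=\mathbb{R}^2/\mathbb{Z}^2$, be the standard map $$f_\varepsilon(x,y)=\left(x+y+\frac{\varepsilon}{2\pi}\sin(2\pi x)\ \mathrm{mod}\ 1,\ \ y+\frac{\varepsilon}{2\pi}\sin(2\pi x)\ \mathrm{mod}\ 1\right).$$ Then its topological entropy satisfies $h(f_\varepsilon)\ge 0.44722970117798$.
   Context: Topological entropy: for a continuous map $f:X\to X$ of a compact metric space, a set $W\subset X$ is $(n,\delta)$-separated if for any two distinct $x,y\in W$ the distance between $f^k(x)$ and $f^k(y)$ exceeds $\delta$ for some $0\le k<n$; with $s(n,\delta)$ the maximal cardinality of an $(n,\delta)$-separated set, $h(f)=\sup_{\delta>0}\limsup_{n\to\infty}\frac{\log s(n,\delta)}{n}$ (natural logarithm). *)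

theory Defs
  imports "HOL-Analysis.Analysis"
begin

section \<open>Topological entropy\<close>

definition separated :: "'a::metric_space set \<Rightarrow> ('a \<Rightarrow> 'a) \<Rightarrow> nat \<Rightarrow> real \<Rightarrow> 'a set \<Rightarrow> bool" where
  "separated X f n \<delta> W \<longleftrightarrow>
     W \<subseteq> X \<and> (\<forall>x\<in>W. \<forall>y\<in>W. x \<noteq> y \<longrightarrow> (\<exists>k<n. dist ((f ^^ k) x) ((f ^^ k) y) > \<delta>))"

text \<open>For a continuous self-map of a compact set and \<open>\<delta> > 0\<close>, the cardinalities below form a
  finite set and no separated set is infinite; see \<open>separated_finite\<close> and
  \<open>max_separated_attained\<close>. Otherwise the value is meaningless.\<close>

definition max_separated :: "'a::metric_space set \<Rightarrow> ('a \<Rightarrow> 'a) \<Rightarrow> nat \<Rightarrow> real \<Rightarrow> nat" where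
  "max_separated X f n \<delta> = Max (card ` {W. separated X f n \<delta> W})"

definition topological_entropy :: "'a::metric_space set \<Rightarrow> ('a \<Rightarrow> 'a) \<Rightarrow> ereal" where
  "topological_entropy X f =
     (SUP \<delta>\<in>{0<..}. limsup (\<lambda>n. ereal (ln (real (max_separated X f n \<delta>)) / real n)))"

lemma separated_card_bounded:
  fixes X :: "'a::metric_space set"
  assumes "compact X" "continuous_on X f" "f ` X \<subseteq> X" "\<delta> > 0"
  obtains N where "\<And>W. separated X f n \<delta> W \<Longrightarrow> finite W \<and> card W \<le> N"
proof -
  have maps: "(f ^^ k) x \<in> X" if "x \<in> X" for k x
    using that assms(3) by (induction k) auto
  have cont: "continuous_on X (f ^^ k)" for k
  proof (induction k)
    case (Suc k)
    have "continuous_on X (f \<circ> (f ^^ k))"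
      using Suc maps by (intro continuous_on_compose continuous_on_subset[OF assms(2)] image_subsetI)
    then show ?case by simp
  qed simp
  have "\<exists>U. open U \<and> x \<in> U \<and> (\<forall>y\<in>U \<inter> X. \<forall>k<n. dist ((f ^^ k) x) ((f ^^ k) y) < \<delta> / 2)"
    if x: "x \<in> X" for x
  proof -
    have "\<exists>U. open U \<and> x \<in> U \<and> (\<forall>y\<in>U \<inter> X. dist ((f ^^ k) x) ((f ^^ k) y) < \<delta> / 2)" for k
    proof -
      have "\<exists>d>0. \<forall>y\<in>X. dist y x < d \<longrightarrow> dist ((f ^^ k) y) ((f ^^ k) x) < \<delta> / 2"
        using cont[of k, unfolded continuous_on_iff, rule_format, OF x, of "\<delta> / 2"] assms(4) by simp
      then obtain d where d: "d > 0"
        "\<And>y. y \<in> X \<Longrightarrow> dist y x < d \<Longrightarrow> dist ((f ^^ k) y) ((f ^^ k) x) < \<delta> / 2" by blast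
      then show ?thesis
        by (intro exI[of _ "ball x d"]) (auto simp: dist_commute)
    qed
    then have "\<forall>k. \<exists>U. open U \<and> x \<in> U \<and> (\<forall>y\<in>U \<inter> X. dist ((f ^^ k) x) ((f ^^ k) y) < \<delta> / 2)"
      by (rule allI)
    from choice[OF this] obtain U where U: "\<And>k. open (U k)" "\<And>k. x \<in> U k"
      "\<And>k y. y \<in> U k \<inter> X \<Longrightarrow> dist ((f ^^ k) x) ((f ^^ k) y) < \<delta> / 2" by blast
    show ?thesis
    proof (intro exI[of _ "\<Inter>k<n. U k"] conjI ballI allI impI)
      show "open (\<Inter>k<n. U k)" using U(1) by (intro open_INT) auto
      show "x \<in> (\<Inter>k<n. U k)" using U(2) by simp
      show "dist ((f ^^ k) x) ((f ^^ k) y) < \<delta> / 2" if "y \<in> (\<Inter>k<n. U k) \<inter> X" "k < n" for y k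
        using that by (intro U(3)) auto
    qed
  qed
  then have "\<forall>x\<in>X. \<exists>U. open U \<and> x \<in> U \<and>
      (\<forall>y\<in>U \<inter> X. \<forall>k<n. dist ((f ^^ k) x) ((f ^^ k) y) < \<delta> / 2)"
    by (rule ballI)
  from bchoice[OF this] obtain U where U: "\<And>x. x \<in> X \<Longrightarrow> open (U x)" "\<And>x. x \<in> X \<Longrightarrow> x \<in> U x"
    "\<And>x y k. x \<in> X \<Longrightarrow> y \<in> U x \<inter> X \<Longrightarrow> k < n \<Longrightarrow> dist ((f ^^ k) x) ((f ^^ k) y) < \<delta> / 2"
    by metis
  have cover: "X \<subseteq> (\<Union>x\<in>X. U x)" using U(2) by blast
  obtain C where C: "C \<subseteq> X" "finite C" "X \<subseteq> (\<Union>c\<in>C. U c)"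
    by (rule compactE_image[OF assms(1) _ cover]) (rule U(1))
  have "finite W \<and> card W \<le> card C" if W: "separated X f n \<delta> W" for W
  proof -
    have "W \<subseteq> X" using W by (simp add: separated_def)
    then have "\<forall>x\<in>W. \<exists>c. c \<in> C \<and> x \<in> U c" using C(3) by (auto dest!: subsetD)
    from bchoice[OF this] obtain g where g: "\<And>x. x \<in> W \<Longrightarrow> g x \<in> C" "\<And>x. x \<in> W \<Longrightarrow> x \<in> U (g x)"
      by blast
    have "inj_on g W"
    proof (rule inj_onI, rule ccontr)
      fix x y assume xy: "x \<in> W" "y \<in> W" "g x = g y" "x \<noteq> y"
      then have "\<exists>k<n. dist ((f ^^ k) x) ((f ^^ k) y) > \<delta>"
        using W by (simp add: separated_def)
      then obtain k where k: "k < n" "dist ((f ^^ k) x) ((f ^^ k) y) > \<delta>"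
        by auto
      have c: "g x \<in> X" "x \<in> U (g x) \<inter> X" "y \<in> U (g x) \<inter> X"
        using g[of x] g[of y] xy C(1) \<open>W \<subseteq> X\<close> by auto
      show False
        using U(3)[OF c(1,2) k(1)] U(3)[OF c(1,3) k(1)] k(2)
          dist_triangle_half_r[of "(f ^^ k) (g x)" "(f ^^ k) x" \<delta> "(f ^^ k) y"]
        by (simp add: dist_commute)
    qed
    moreover have "g ` W \<subseteq> C" using g by blast
    ultimately show ?thesis using C(2) card_inj_on_le inj_on_finite by blast
  qed
  then show ?thesis by (rule that)
qed

lemma separated_finite:
  fixes X :: "'a::metric_space set"
  assumes "compact X" "continuous_on X f" "f ` X \<subseteq> X" "\<delta> > 0" "separated X f n \<delta> W"
  shows "finite W"
proof -
  obtain N where "\<And>W. separated X f n \<delta> W \<Longrightarrow> finite W \<and> card W \<le> N"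
    using separated_card_bounded[OF assms(1-4)] by blast
  then show ?thesis using assms(5) by blast
qed

lemma max_separated_attained:
  fixes X :: "'a::metric_space set"
  assumes "compact X" "continuous_on X f" "f ` X \<subseteq> X" "\<delta> > 0"
  shows "\<exists>W. separated X f n \<delta> W \<and> card W = max_separated X f n \<delta>"
    and "separated X f n \<delta> W \<Longrightarrow> card W \<le> max_separated X f n \<delta>"
proof -
  obtain N where N: "\<And>W. separated X f n \<delta> W \<Longrightarrow> finite W \<and> card W \<le> N"
    using separated_card_bounded[OF assms] by blast
  have fin: "finite (card ` {W. separated X f n \<delta> W})"
    by (rule finite_subset[of _ "{..N}"]) (use N in auto)
  have "separated X f n \<delta> {}" by (simp add: separated_def)
  then have ne: "card ` {W. separated X f n \<delta> W} \<noteq> {}" by blast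
  show "\<exists>W. separated X f n \<delta> W \<and> card W = max_separated X f n \<delta>"
    using Max_in[OF fin ne] unfolding max_separated_def by auto
  show "separated X f n \<delta> W \<Longrightarrow> card W \<le> max_separated X f n \<delta>"
    unfolding max_separated_def by (intro Max_ge[OF fin]) auto
qed

section \<open>The torus\<close>

definition torus_rel :: "real \<times> real \<Rightarrow> real \<times> real \<Rightarrow> bool" where
  "torus_rel p q \<longleftrightarrow> fst p - fst q \<in> \<int> \<and> snd p - snd q \<in> \<int>"

lemma torus_rel_refl: "torus_rel p p"
  by (simp add: torus_rel_def)

lemma torus_rel_sym: "torus_rel p q \<Longrightarrow> torus_rel q p"
  using Ints_minus[of "fst p - fst q"] Ints_minus[of "snd p - snd q"] by (simp add: torus_rel_def)

lemma torus_rel_trans: "torus_rel p q \<Longrightarrow> torus_rel q r \<Longrightarrow> torus_rel p r"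
  using Ints_add[of "fst p - fst q" "fst q - fst r"] Ints_add[of "snd p - snd q" "snd q - snd r"]
  by (simp add: torus_rel_def)

quotient_type torus = "real \<times> real" / torus_rel
  morphisms rep_torus to_torus
  by (intro equivpI reflpI sympI transpI)
    (auto intro: torus_rel_refl torus_rel_sym torus_rel_trans)

lemma to_torus_eq_iff: "to_torus p = to_torus q \<longleftrightarrow> torus_rel p q"
  by (rule torus.abs_eq_iff)

lemma to_torus_surj: "\<exists>p. to_torus p = P"
  by (induction P rule: torus.abs_induct) blast

definition torus_fibre :: "torus \<Rightarrow> (real \<times> real) set" where
  "torus_fibre P = {p. to_torus p = P}"

lemma torus_fibre_to_torus: "torus_fibre (to_torus p) = {q. torus_rel q p}"
  by (simp add: torus_fibre_def to_torus_eq_iff)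

lemma torus_fibre_ne: "torus_fibre P \<noteq> {}"
  using to_torus_surj[of P] by (auto simp: torus_fibre_def)

lemma torus_fibre_closed: "closed (torus_fibre P)"
proof -
  obtain p where p: "P = to_torus p" using to_torus_surj[of P] by blast
  have "torus_fibre P = (\<lambda>q. q - p) -` (\<int> \<times> \<int>)"
    by (simp add: p torus_fibre_to_torus torus_rel_def mem_Times_iff vimage_def)
  moreover have "closed ((\<lambda>q. q - p) -` (\<int> \<times> \<int>))"
    by (intro continuous_closed_vimage closed_Times closed_Ints continuous_intros)
  ultimately show ?thesis by simp
qed

lemma setdist_torus_fibre:
  assumes "p \<in> torus_fibre P"
  shows "setdist {p} (torus_fibre Q) = setdist (torus_fibre P) (torus_fibre Q)"
proof (rule antisym)
  show "setdist (torus_fibre P) (torus_fibre Q) \<le> setdist {p} (torus_fibre Q)"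
    by (rule setdist_le_sing[OF assms])
  show "setdist {p} (torus_fibre Q) \<le> setdist (torus_fibre P) (torus_fibre Q)"
  proof (rule le_setdistI)
    fix p' q' assume *: "p' \<in> torus_fibre P" "q' \<in> torus_fibre Q"
    have "torus_rel p p'" using assms * by (simp add: torus_fibre_def flip: to_torus_eq_iff)
    moreover have "torus_rel (q' + (p - p')) q' \<longleftrightarrow> torus_rel p p'"
      by (simp add: torus_rel_def)
    ultimately have "q' + (p - p') \<in> torus_fibre Q"
      using *(2) by (auto simp: torus_fibre_def simp flip: to_torus_eq_iff)
    then have "setdist {p} (torus_fibre Q) \<le> dist p (q' + (p - p'))"
      by (intro setdist_le_dist) auto
    also have "dist p (q' + (p - p')) = dist p' q'"
      by (simp add: dist_norm algebra_simps)
    finally show "setdist {p} (torus_fibre Q) \<le> dist p' q'" .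
  qed (use torus_fibre_ne in auto)
qed

text \<open>The flat metric: the distance between two points of the torus is the infimum of the Euclidean
  distances between their representatives.\<close>

instantiation torus :: metric_space
begin

definition dist_torus :: "torus \<Rightarrow> torus \<Rightarrow> real" where
  "dist_torus P Q = setdist (torus_fibre P) (torus_fibre Q)"

definition uniformity_torus :: "(torus \<times> torus) filter" where
  "uniformity_torus = (INF e\<in>{0 <..}. principal {(P, Q). dist P Q < e})"

definition open_torus :: "torus set \<Rightarrow> bool" where
  "open_torus U \<longleftrightarrow> (\<forall>P\<in>U. eventually (\<lambda>(P', Q). P' = P \<longrightarrow> Q \<in> U) uniformity)"

instance
proof
  fix P Q R :: torus
  show "dist P Q = 0 \<longleftrightarrow> P = Q"
  proof
    assume "dist P Q = 0"
    obtain p where p: "p \<in> torus_fibre P" using torus_fibre_ne by blast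
    have "setdist {p} (torus_fibre Q) = 0"
      using \<open>dist P Q = 0\<close> setdist_torus_fibre[OF p] by (simp add: dist_torus_def)
    then have "p \<in> torus_fibre Q"
      using setdist_eq_0_sing_1[of p "torus_fibre Q"] torus_fibre_ne torus_fibre_closed by auto
    then show "P = Q" using p by (simp add: torus_fibre_def)
  next
    assume "P = Q"
    then show "dist P Q = 0" by (simp add: dist_torus_def setdist_refl)
  qed
  obtain r where r: "r \<in> torus_fibre R" using torus_fibre_ne by blast
  show "dist P Q \<le> dist P R + dist Q R"
    using setdist_triangle[of "torus_fibre P" "torus_fibre Q" r]
      setdist_torus_fibre[OF r, of P] setdist_torus_fibre[OF r, of Q]
    by (simp add: dist_torus_def setdist_sym)
qed (simp_all only: uniformity_torus_def open_torus_def)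

end

lemma dist_to_torus_le: "dist (to_torus p) (to_torus q) \<le> dist p q"
  unfolding dist_torus_def by (rule setdist_le_dist) (simp_all add: torus_fibre_def)

lemma continuous_on_to_torus: "continuous_on A to_torus"
  unfolding continuous_on_iff using dist_to_torus_le le_less_trans by blast

lemma compact_torus: "compact (UNIV :: torus set)"
proof -
  have "P \<in> to_torus ` ({0..1} \<times> {0..1})" for P
  proof -
    obtain p where p: "P = to_torus p" using to_torus_surj[of P] by blast
    have "to_torus (frac (fst p), frac (snd p)) = P"
      by (simp add: p to_torus_eq_iff torus_rel_def frac_def)
    moreover have "(frac (fst p), frac (snd p)) \<in> {0..1} \<times> {0..1}"
      by (auto simp: less_imp_le[OF frac_lt_1])
    ultimately show ?thesis by blast
  qed
  then have "UNIV = to_torus ` ({0..1} \<times> {0..1})" by blast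
  moreover have "compact (to_torus ` ({0..1} \<times> {0..1}))"
    by (intro compact_continuous_image continuous_on_to_torus compact_Times compact_Icc)
  ultimately show ?thesis by (rule ssubst)
qed

section \<open>The standard map\<close>

lift_definition standard_map :: "real \<Rightarrow> torus \<Rightarrow> torus" is
  "\<lambda>\<epsilon> (x, y). (x + y + \<epsilon> / (2 * pi) * sin (2 * pi * x), y + \<epsilon> / (2 * pi) * sin (2 * pi * x))"
proof -
  fix \<epsilon> :: real and p q :: "real \<times> real"
  assume rel: "torus_rel p q"
  obtain x y where p: "p = (x, y)" by fastforce
  obtain x' y' where q: "q = (x', y')" by fastforce
  obtain m :: int where "x - x' = of_int m"
    using rel by (auto simp: p q torus_rel_def elim: Ints_cases)
  then have "x = x' + of_int m" by simp
  then have "sin (2 * pi * x) = sin (2 * pi * x')"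
    by (simp add: ring_distribs sin_add)
  moreover have "(x + y) - (x' + y') \<in> \<int>"
    using rel Ints_add[of "x - x'" "y - y'"] by (simp add: p q torus_rel_def algebra_simps)
  ultimately show
    "torus_rel (case p of (x, y) \<Rightarrow> (x + y + \<epsilon> / (2 * pi) * sin (2 * pi * x), y + \<epsilon> / (2 * pi) * sin (2 * pi * x)))
       (case q of (x, y) \<Rightarrow> (x + y + \<epsilon> / (2 * pi) * sin (2 * pi * x), y + \<epsilon> / (2 * pi) * sin (2 * pi * x)))"
    using rel by (simp add: p q torus_rel_def)
qed

lemma continuous_on_standard_map: "continuous_on A (standard_map \<epsilon>)"
proof -
  define F :: "real \<times> real \<Rightarrow> real \<times> real" where
    "F = (\<lambda>p. (fst p + snd p + \<epsilon> / (2 * pi) * sin (2 * pi * fst p),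
               snd p + \<epsilon> / (2 * pi) * sin (2 * pi * fst p)))"
  have F: "standard_map \<epsilon> (to_torus p) = to_torus (F p)" for p
    by (simp add: standard_map.abs_eq F_def case_prod_beta)
  have cont_F: "continuous_on UNIV F"
    unfolding F_def by (intro continuous_intros)
  show ?thesis
    unfolding continuous_on_iff
  proof (intro ballI allI impI)
    fix P :: torus and e :: real
    assume "e > 0"
    obtain p where p: "P = to_torus p" using to_torus_surj[of P] by blast
    obtain d where d: "d > 0" "\<And>q. dist q p < d \<Longrightarrow> dist (F q) (F p) < e"
      using cont_F[unfolded continuous_on_iff, rule_format, of p e] \<open>e > 0\<close> by auto
    have "dist (standard_map \<epsilon> Q) (standard_map \<epsilon> P) < e" if "dist Q P < d" for Q
    proof -
      have "p \<in> torus_fibre P" by (simp add: p torus_fibre_def)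
      then have "setdist {p} (torus_fibre Q) < d"
        using that setdist_torus_fibre by (simp add: dist_torus_def setdist_sym)
      then obtain q where q: "q \<in> torus_fibre Q" "dist p q < d"
        using torus_fibre_ne by (elim setdist_ltE) auto
      then have "dist (to_torus (F q)) (to_torus (F p)) < e"
        using d(2)[of q] dist_to_torus_le[of "F q" "F p"] by (simp add: dist_commute)
      moreover have "Q = to_torus q" using q(1) by (simp add: torus_fibre_def)
      ultimately show ?thesis by (simp add: F p)
    qed
    with d(1) show "\<exists>d>0. \<forall>Q\<in>A. dist Q P < d \<longrightarrow> dist (standard_map \<epsilon> Q) (standard_map \<epsilon> P) < e"
      by blast
  qed
qed

end

theory Submission
  imports Defs
begin

text \<open>
  Write an orbit of the standard map with parameter 2 as the sequence of its lifted positions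
  \<open>x\<^sub>n\<close>, the momentum being \<open>x\<^sub>n - x\<^sub>n\<^sub>-\<^sub>1\<close>.  The map becomes the recurrence
  \<open>x\<^sub>n\<^sub>+\<^sub>1 + x\<^sub>n\<^sub>-\<^sub>1 = g x\<^sub>n\<close> with \<open>g x = 2 x + sin (2 pi x) / pi\<close>, whose right-hand side is
  nondecreasing.  The integers are hyperbolic fixed points, and there are two kinds of
  heteroclinic orbits from 0 to 1, called kinks below: one passes through the point 1/2,
  \<open>\<dots>, 0.04, 0.14, 0.50, 0.86, 0.96, \<dots>\<close>, the other one jumps across it,
  \<open>\<dots>, 0.07, 0.25, 0.75, 0.93, \<dots>\<close>.  Reflection gives two kinks from 0 to -1.  On the torus these
  are four homoclinic orbits of one fixed point, and they generate a horseshoe.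

  The horseshoe is found with the intermediate value theorem alone.  Consider the window of all
  \<open>(x\<^sub>0, x\<^sub>1)\<close> with \<open>\<bar>x\<^sub>0\<bar> \<le> 0.195\<close> and \<open>\<bar>x\<^sub>2\<bar> \<le> 0.375\<close>, and call a path in it
  transverse if \<open>x\<^sub>2\<close> runs from one end of its range to the other.  Along a transverse
  path \<open>x\<^sub>3\<close> covers \<open>[-0.815, 0.815]\<close>.  The piece with \<open>\<bar>x\<^sub>3\<bar> \<le> 0.375\<close> contains
  a subpath whose image after one step is transverse again; the pieces with
  \<open>x\<^sub>3 \<in> [0.4, 0.62]\<close> and \<open>x\<^sub>3 \<in> [0.65, 0.815]\<close> follow the two kinks and contain subpaths
  whose images after four steps, translated by -1, are transverse (lemmas
  \<open>gate_identity\<close>, \<open>gate_on_site_kink\<close>, \<open>gate_off_site_kink\<close> and \<open>gate_passage\<close>); the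
  reflected pieces behave in the same way.  The five pieces are separated
  by their values of \<open>x\<^sub>3\<close>.  Hence the number \<open>a\<^sub>N\<close> of points on a
  transverse path that are pairwise told apart within \<open>N\<close> steps at a fixed scale satisfies
  \<open>a\<^sub>N \<ge> a\<^sub>N\<^sub>-\<^sub>1 + 4 a\<^sub>N\<^sub>-\<^sub>4\<close> (lemma \<open>transverse_resolved_points\<close>).  As
  \<open>1.7^3 + 4 > 1.7^4\<close>, it grows at least like \<open>1.7^N\<close>, and \<open>ln 1.7 > 0.53\<close>.

  The sizes of the window are a compromise.  They must be large enough for the kinks to return
  into the window from every starting point of it, and small enough that the dependence of
  \<open>x\<^sub>2\<close> on \<open>x\<^sub>0\<close>, for prescribed \<open>x\<^sub>3\<close>, can be controlled by the comparison principle
  \<open>second_site_le\<close>.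
\<close>

section \<open>The sum of the two neighbours of a site\<close>

text \<open>The function \<open>g\<close> of the recurrence.  The parameter 2 is the largest one for
  which it is monotone.\<close>

definition nsum :: "real \<Rightarrow> real" where
  "nsum x = 2 * x + sin (2 * pi * x) / pi"

lemma nsum_minus [simp]: "nsum (- x) = - nsum x"
  by (simp add: nsum_def)

lemma nsum_add_one: "nsum (x + 1) = nsum x + 2"
  by (simp add: nsum_def sin_add ring_distribs)

lemma nsum_reflect: "nsum x = 2 - nsum (1 - x)"
  using nsum_add_one[of "- x"] by (simp add: add.commute)

lemma nsum_has_derivative:
  "(nsum has_real_derivative 4 * (cos (pi * x))\<^sup>2) (at x)"
proof -
  have "(nsum has_real_derivative (2 + cos (2 * pi * x) * (2 * pi) / pi)) (at x)"
    unfolding nsum_def by (auto intro!: derivative_eq_intros)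
  moreover have "2 + cos (2 * pi * x) * (2 * pi) / pi = 4 * (cos (pi * x))\<^sup>2"
    using cos_double_cos[of "pi * x"] by (simp add: mult.assoc)
  ultimately show ?thesis by simp
qed

lemma continuous_on_nsum [continuous_intros]:
  assumes "continuous_on A f"
  shows "continuous_on A (\<lambda>x. nsum (f x))"
proof -
  have "continuous_on UNIV nsum"
    using nsum_has_derivative by (intro continuous_at_imp_continuous_on) (auto intro: DERIV_isCont)
  then show ?thesis
    using assms by (rule continuous_on_compose2) simp
qed

lemma nsum_mono: "x \<le> y \<Longrightarrow> nsum x \<le> nsum y"
  by (rule DERIV_nonneg_imp_nondecreasing[of x y nsum]) (use nsum_has_derivative in force)+

lemma nsum_lipschitz: "\<bar>nsum x - nsum y\<bar> \<le> 4 * \<bar>x - y\<bar>"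
proof -
  have *: "nsum y - nsum x \<le> 4 * (y - x)" if "x \<le> y" for x y
  proof -
    have "4 * x - nsum x \<le> 4 * y - nsum y"
    proof (rule DERIV_nonneg_imp_nondecreasing[OF that])
      fix z
      have "((\<lambda>x. 4 * x - nsum x) has_real_derivative (4 - 4 * (cos (pi * z))\<^sup>2)) (at z)"
        by (auto intro!: derivative_eq_intros nsum_has_derivative)
      then show "\<exists>D. ((\<lambda>x. 4 * x - nsum x) has_real_derivative D) (at z) \<and> 0 \<le> D"
        using abs_cos_le_one[of "pi * z"] by (intro exI conjI) (auto simp: abs_square_le_1)
    qed
    then show ?thesis by simp
  qed
  show ?thesis
    using *[of x y] *[of y x] nsum_mono[of x y] nsum_mono[of y x] by (cases "x \<le> y") auto
qed

text \<open>The remainder is the one of the Taylor polynomial of degree 8, whose last coefficient vanishes.\<close>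

lemma sin_taylor:
  fixes y :: real
  assumes "0 \<le> y"
  shows "\<bar>sin y - (y - y^3/6 + y^5/120 - y^7/5040)\<bar> \<le> y^9 / 362880"
proof -
  have "(\<Sum>m<9. sin_coeff m * y ^ m) = y - y^3/6 + y^5/120 - y^7/5040"
    by (simp add: lessThan_nat_numeral lessThan_Suc sin_coeff_def fact_numeral)
  moreover have "inverse (fact 9) * \<bar>y\<bar> ^ 9 = y^9 / 362880"
    using assms by (simp add: fact_numeral)
  ultimately show ?thesis
    using Maclaurin_sin_bound[of y 9] by (simp only:)
qed

text \<open>The Taylor polynomial of degree 7 of \<open>nsum\<close> at 0, with rounded coefficients; the accuracy
  below is what the narrowest of the later estimates requires.\<close>

definition nsum_poly :: "real \<Rightarrow> real" where
  "nsum_poly x = 4 * x - 13.15947 * x^3 + 25.97576 * x^5 - 24.41623 * x^7"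

lemma nsum_approx:
  assumes "0 \<le> x" "x \<le> 1/4"
  shows "\<bar>nsum x - nsum_poly x\<bar> \<le> 7/100000"
proof -
  have p: "3.14159265 \<le> pi" "pi \<le> 3.14159266" using pi_approx by auto
  have p2: "9.869604 \<le> pi^2" "pi^2 \<le> 9.869605"
    using power_mono[OF p(1), of 2] power_mono[OF p(2), of 2] by (auto simp: power2_eq_square)
  have eqs: "pi^4 = (pi^2)^2" "pi^6 = (pi^2)^3" "pi^8 = (pi^2)^4"
    by (simp_all flip: power_mult)
  have p4: "97.40908 \<le> pi^4" "pi^4 \<le> 97.40911"
    unfolding eqs using power_mono[OF p2(1), of 2] power_mono[OF p2(2), of 2]
    by (simp_all add: power_divide del: power_mult_numeral)
  have p6: "961.3888 \<le> pi^6" "pi^6 \<le> 961.3895"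
    unfolding eqs using power_mono[OF p2(1), of 3] power_mono[OF p2(2), of 3]
    by (simp_all add: power_divide del: power_mult_numeral)
  have p8: "pi^8 \<le> 9489"
    unfolding eqs using power_mono[OF p2(2), of 4]
    by (simp add: power_divide del: power_mult_numeral)
  have xs: "x^3 \<le> (1/4)^3" "x^5 \<le> (1/4)^5" "x^7 \<le> (1/4)^7" "x^9 \<le> (1/4)^9"
    "0 \<le> x^3" "0 \<le> x^5" "0 \<le> x^7" "0 \<le> x^9"
    using assms by (auto intro!: power_mono simp del: power_one_over)
  define r where "r = sin (2*pi*x) / pi"
  have "\<bar>sin (2*pi*x) - (2*pi*x - (2*pi*x)^3/6 + (2*pi*x)^5/120 - (2*pi*x)^7/5040)\<bar> / pi
      \<le> (2*pi*x)^9 / 362880 / pi"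
    using sin_taylor[of "2*pi*x"] assms by (intro divide_right_mono) auto
  also have "(2*pi*x)^9 / 362880 / pi = 512/362880 * pi^8 * x^9"
    by (simp add: power_mult_distrib eval_nat_numeral)
  also have "\<dots> \<le> 512/362880 * 9489 * (1/4)^9"
    using p8 xs by (intro mult_mono) auto
  also have "\<dots> \<le> 6/100000" by (simp add: power_divide)
  finally have "\<bar>sin (2*pi*x) / pi - (2*pi*x - (2*pi*x)^3/6 + (2*pi*x)^5/120 - (2*pi*x)^7/5040) / pi\<bar> \<le> 6/100000"
    by (simp add: abs_divide diff_divide_distrib[symmetric])
  moreover have "(2*pi*x - (2*pi*x)^3/6 + (2*pi*x)^5/120 - (2*pi*x)^7/5040) / pi =
      2 * x - (8/6*pi^2) * x^3 + (32/120*pi^4) * x^5 - (128/5040*pi^6) * x^7"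
    by (simp add: power_mult_distrib field_simps eval_nat_numeral)
  ultimately have main: "\<bar>sin (2*pi*x) / pi -
      (2 * x - (8/6*pi^2) * x^3 + (32/120*pi^4) * x^5 - (128/5040*pi^6) * x^7)\<bar> \<le> 6/100000"
    by simp
  have c3: "\<bar>8/6*pi^2 - 13.15947\<bar> \<le> 0.00001"
    and c5: "\<bar>32/120*pi^4 - 25.97576\<bar> \<le> 0.0001"
    and c7: "\<bar>128/5040*pi^6 - 24.41623\<bar> \<le> 0.0001"
    unfolding abs_le_iff using p2 p4 p6 by simp_all
  have e3: "\<bar>(8/6*pi^2) * x^3 - 13.15947 * x^3\<bar> \<le> 0.00001 * (1/4)^3"
    unfolding left_diff_distrib[symmetric] abs_mult using c3 xs by (intro mult_mono) simp_all
  have e5: "\<bar>(32/120*pi^4) * x^5 - 25.97576 * x^5\<bar> \<le> 0.0001 * (1/4)^5"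
    unfolding left_diff_distrib[symmetric] abs_mult using c5 xs by (intro mult_mono) simp_all
  have e7: "\<bar>(128/5040*pi^6) * x^7 - 24.41623 * x^7\<bar> \<le> 0.0001 * (1/4)^7"
    unfolding left_diff_distrib[symmetric] abs_mult using c7 xs by (intro mult_mono) simp_all
  have sum: "\<bar>2 * x + s - (4 * x - a' + b' - c')\<bar> \<le> e + e1 + e2 + e3"
    if "\<bar>s - (2 * x - a + b - c)\<bar> \<le> e" "\<bar>a - a'\<bar> \<le> e1" "\<bar>b - b'\<bar> \<le> e2" "\<bar>c - c'\<bar> \<le> e3"
    for s a b c a' b' c' e e1 e2 e3 :: real
    using that by linarith
  have "\<bar>nsum x - nsum_poly x\<bar> \<le> 6/100000 + 0.00001 * (1/4)^3 + 0.0001 * (1/4)^5 + 0.0001 * (1/4)^7"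
    unfolding nsum_def nsum_poly_def by (rule sum[OF main e3 e5 e7])
  also have "\<dots> \<le> 7/100000" by (simp add: power_divide)
  finally show ?thesis .
qed

lemma nsum_half_reflect: "nsum x = 4 * x - 1 + nsum (1/2 - x)"
proof -
  have "sin (2 * pi * (1/2 - x)) = sin (2 * pi * x)"
    by (simp add: right_diff_distrib sin_diff)
  then show ?thesis by (simp add: nsum_def)
qed

lemma nsum_ge:
  assumes "0 \<le> x" "x \<le> 1/4" "c \<le> nsum_poly x - 7/100000"
  shows "c \<le> nsum x"
  using nsum_approx[OF assms(1,2)] assms(3) by linarith

lemma nsum_le:
  assumes "0 \<le> x" "x \<le> 1/4" "nsum_poly x + 7/100000 \<le> c"
  shows "nsum x \<le> c"
  using nsum_approx[OF assms(1,2)] assms(3) by linarith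

lemma nsum_far_ge:
  assumes "1/4 \<le> x" "x \<le> 1/2" "c \<le> 4 * x - 1 + nsum_poly (1/2 - x) - 7/100000"
  shows "c \<le> nsum x"
  using nsum_approx[of "1/2 - x"] nsum_half_reflect[of x] assms by linarith

lemma nsum_far_le:
  assumes "1/4 \<le> x" "x \<le> 1/2" "4 * x - 1 + nsum_poly (1/2 - x) + 7/100000 \<le> c"
  shows "nsum x \<le> c"
  using nsum_approx[of "1/2 - x"] nsum_half_reflect[of x] assms by linarith

text \<open>The values of \<open>nsum\<close> on which the estimates for the kinks rest.  The arguments in
  \<open>[1/4, 1/2]\<close> and beyond \<open>1/2\<close> are reduced to \<open>[0, 1/4]\<close> by the symmetries of the sine.\<close>

lemma
  shows nsum_0_005_ge: "0.017 \<le> nsum 0.005"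
    and nsum_0_008_ge: "0.028 \<le> nsum 0.008"
    and nsum_0_025_ge: "0.099 \<le> nsum 0.025"
    and nsum_0_071_ge: "0.2792 \<le> nsum 0.071"
    and nsum_0_083_ge: "0.323 \<le> nsum 0.083"
    and nsum_0_097_ge: "0.376 \<le> nsum 0.097"
    and nsum_0_105_ge: "0.404 \<le> nsum 0.105"
    and nsum_0_109_ge: "0.418 \<le> nsum 0.109"
    and nsum_0_128_ge: "0.483 \<le> nsum 0.128"
    and nsum_0_135_ge: "0.5085 \<le> nsum 0.135"
    and nsum_0_144_ge: "0.538 \<le> nsum 0.144"
    and nsum_0_149_ge: "0.554 \<le> nsum 0.149"
    and nsum_0_155_ge: "0.573 \<le> nsum 0.155"
    and nsum_0_158_ge: "0.58 \<le> nsum 0.158"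
    and nsum_0_18_ge: "0.647 \<le> nsum 0.18"
    and nsum_0_185_ge: "0.662 \<le> nsum 0.185"
    and nsum_0_195_ge: "0.689 \<le> nsum 0.195"
    and nsum_0_209_ge: "0.725 \<le> nsum 0.209"
    and nsum_0_223_ge: "0.759 \<le> nsum 0.223"
    and nsum_0_239_ge: "0.795 \<le> nsum 0.239"
  by (rule nsum_ge; simp add: nsum_poly_def power_divide)+

lemma
  shows nsum_0_022_le: "nsum 0.022 \<le> 0.088"
    and nsum_0_096_le: "nsum 0.096 \<le> 0.375"
    and nsum_0_141_le: "nsum 0.141 \<le> 0.5287"
    and nsum_0_167_le: "nsum 0.167 \<le> 0.612"
    and nsum_0_178_le: "nsum 0.178 \<le> 0.645"
    and nsum_0_185_le: "nsum 0.185 \<le> 0.6623"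
  by (rule nsum_le; simp add: nsum_poly_def power_divide)+

lemma
  shows nsum_0_35_ge: "0.9573 \<le> nsum 0.35"
    and nsum_0_359_ge: "0.964 \<le> nsum 0.359"
    and nsum_0_375_ge: "0.9749 \<le> nsum 0.375"
    and nsum_0_38_ge: "0.9777 \<le> nsum 0.38"
    and nsum_0_4_ge: "0.987 \<le> nsum 0.4"
  by (rule nsum_far_ge; simp add: nsum_poly_def power_divide)+

lemma
  shows nsum_0_35_le: "nsum 0.35 \<le> 0.9577"
    and nsum_0_38_le: "nsum 0.38 \<le> 0.978"
    and nsum_0_4_le: "nsum 0.4 \<le> 0.9872"
  by (rule nsum_far_le; simp add: nsum_poly_def power_divide)+

text \<open>The derivative \<open>4 (cos (pi z))\<^sup>2\<close> decreases in \<open>\<bar>z\<bar>\<close> on \<open>[-1/2, 1/2]\<close>.\<close>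

lemma nsum_slope:
  assumes "\<bar>x\<bar> \<le> a" "\<bar>y\<bar> \<le> a" "x \<le> y" "a \<le> 1/2"
  shows "4 * (cos (pi * a))\<^sup>2 * (y - x) \<le> nsum y - nsum x"
proof -
  let ?m = "4 * (cos (pi * a))\<^sup>2"
  have "nsum x - ?m * x \<le> nsum y - ?m * y"
  proof (rule DERIV_nonneg_imp_nondecreasing[OF assms(3)])
    fix z assume z: "x \<le> z" "z \<le> y"
    have "pi * a \<le> pi / 2" "0 \<le> pi * a"
      using assms mult_left_mono[of a "1/2" pi] by auto
    then have "0 \<le> cos (pi * a)"
      using pi_gt_zero by (intro cos_ge_zero) linarith+
    moreover have "pi * \<bar>z\<bar> \<le> pi * a"
      using z assms by (intro mult_left_mono) auto
    then have "cos (pi * a) \<le> cos (pi * \<bar>z\<bar>)"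
      using \<open>pi * a \<le> pi / 2\<close> pi_gt_zero by (intro cos_monotone_0_pi_le) auto
    moreover have "cos (pi * \<bar>z\<bar>) = cos (pi * z)" by (cases "0 \<le> z") auto
    ultimately have "(cos (pi * a))\<^sup>2 \<le> (cos (pi * z))\<^sup>2" by (intro power_mono) auto
    moreover have "((\<lambda>x. nsum x - ?m * x) has_real_derivative (4 * (cos (pi * z))\<^sup>2 - ?m)) (at z)"
      by (auto intro!: derivative_eq_intros nsum_has_derivative)
    ultimately show "\<exists>D. ((\<lambda>x. nsum x - ?m * x) has_real_derivative D) (at z) \<and> 0 \<le> D"
      by (intro exI conjI) auto
  qed
  then show ?thesis by (simp add: algebra_simps)
qed

lemma nsum_slope_quarter:
  assumes "\<bar>x\<bar> \<le> 1/4" "\<bar>y\<bar> \<le> 1/4" "x \<le> y"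
  shows "2 * (y - x) \<le> nsum y - nsum x"
  using nsum_slope[of x "1/4" y] assms by (simp add: cos_45 power_divide)

lemma nsum_slope_three_eighths:
  assumes "\<bar>x\<bar> \<le> 3/8" "\<bar>y\<bar> \<le> 3/8" "x \<le> y"
  shows "0.58 * (y - x) \<le> nsum y - nsum x"
proof -
  have "cos (2 * (pi * (3/8))) = cos (pi - pi / 4)" by (rule arg_cong[of _ _ cos]) simp
  also have "\<dots> = - cos (pi / 4)" unfolding cos_diff cos_pi sin_pi by simp
  finally have "2 * (cos (pi * (3/8)))\<^sup>2 - 1 = - (sqrt 2 / 2)"
    unfolding cos_double_cos cos_45 .
  then have "4 * (cos (pi * (3/8)))\<^sup>2 = 2 - sqrt 2" by linarith
  moreover have "sqrt 2 \<le> 1.42" by (rule real_le_lsqrt) (auto simp: power2_eq_square)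
  ultimately have "0.58 * (y - x) \<le> 4 * (cos (pi * (3/8)))\<^sup>2 * (y - x)"
    using assms by (intro mult_right_mono) auto
  then show ?thesis using nsum_slope[of x "3/8" y] assms by simp
qed

text \<open>A comparison principle for two consecutive sites with prescribed outer neighbours.  The pair
  \<open>(b, B)\<close> is a supersolution of the two equations, and the pair \<open>(x1, x2)\<close> must stay
  below it because the product \<open>2 * 0.58\<close> of the two slopes exceeds 1: an excess \<open>x2 - B > 0\<close>
  would force an excess of \<open>x1\<close> over \<open>b\<close> of at most half its size, whereas the second equation
  needs at least \<open>0.58\<close> of it.\<close>

lemma second_site_le:
  assumes orbit: "nsum x1 = x0 + x2" "nsum x2 = x1 + x3"
    and bounds: "x0 \<le> 0.195" "x3 \<le> q" "\<bar>x1\<bar> \<le> 1/4" "\<bar>x2\<bar> \<le> 3/8"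
    and super: "0.195 + B \<le> nsum b" "b + q \<le> nsum B" "\<bar>b\<bar> \<le> 1/4" "\<bar>B\<bar> \<le> 3/8"
  shows "x2 \<le> B"
proof (rule ccontr)
  assume "\<not> x2 \<le> B"
  then have B: "B < x2" by simp
  then have 1: "0.58 * (x2 - B) \<le> nsum x2 - nsum B"
    using bounds super by (intro nsum_slope_three_eighths) auto
  show False
  proof (cases "x1 \<le> b")
    case True
    then show False using 1 B orbit bounds super by simp
  next
    case False
    then have "2 * (x1 - b) \<le> nsum x1 - nsum b"
      using bounds super by (intro nsum_slope_quarter) auto
    then show False using 1 B orbit bounds super by simp
  qed
qed

text \<open>The reflected principle: \<open>(- b, B)\<close> is a subsolution.\<close>

lemma second_site_ge:
  assumes orbit: "nsum x1 = x0 + x2" "nsum x2 = x1 + x3"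
    and bounds: "- 0.195 \<le> x0" "q \<le> x3" "\<bar>x1\<bar> \<le> 1/4" "\<bar>x2\<bar> \<le> 3/8"
    and sub: "0.195 - B \<le> nsum b" "nsum B \<le> q - b" "\<bar>b\<bar> \<le> 1/4" "\<bar>B\<bar> \<le> 3/8"
  shows "B \<le> x2"
  using second_site_le[of "- x1" "- x0" "- x2" "- x3" "- q" "- B" b] assms by simp

lemma first_site_small:
  assumes "nsum x1 = x0 + x2" "\<bar>x0\<bar> \<le> 0.195" "\<bar>x2\<bar> \<le> 0.375"
  shows "\<bar>x1\<bar> \<le> 0.155"
proof -
  have *: "x1 \<le> 0.155" if "nsum x1 \<le> 0.57" for x1
  proof (rule ccontr)
    assume "\<not> x1 \<le> 0.155"
    then have "nsum 0.155 \<le> nsum x1" by (intro nsum_mono) simp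
    then show False using nsum_0_155_ge that by simp
  qed
  show ?thesis using *[of x1] *[of "- x1"] assms unfolding abs_le_iff by simp
qed

lemma
  shows nsum_0_62_ge: "1.022 \<le> nsum 0.62" and nsum_0_62_le: "nsum 0.62 \<le> 1.0223"
    and nsum_0_65_ge: "1.0423 \<le> nsum 0.65" and nsum_0_65_le: "nsum 0.65 \<le> 1.0427"
    and nsum_0_815_ge: "1.3377 \<le> nsum 0.815" and nsum_0_815_le: "nsum 0.815 \<le> 1.338"
  using nsum_reflect[of "0.62"] nsum_0_38_ge nsum_0_38_le
    nsum_reflect[of "0.65"] nsum_0_35_ge nsum_0_35_le
    nsum_reflect[of "0.815"] nsum_0_185_ge nsum_0_185_le
  by simp_all

section \<open>Estimates along the two kinks\<close>

text \<open>Sites 4, 5 and 6 are measured from 1, the point that the kinks approach; the equations for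
  \<open>y5\<close> and \<open>y6\<close> use \<open>nsum (x + 1) = nsum x + 2\<close>.  At the ends of the two ranges of \<open>x3\<close> the
  bounds on \<open>x2\<close> from the comparison principle are tight enough to follow the orbit to site 6 by
  interval arithmetic.\<close>

context
  fixes x0 x1 x2 x3 y4 y5 y6 :: real
  assumes orbit: "nsum x1 = x0 + x2" "nsum x2 = x1 + x3" "y4 = nsum x3 - x2 - 1"
      "y5 = nsum y4 - x3 + 1" "y6 = nsum y5 - y4"
    and bounds: "\<bar>x0\<bar> \<le> 0.195" "\<bar>x2\<bar> \<le> 0.375"
begin

lemma x1_small: "\<bar>x1\<bar> \<le> 0.155"
  using orbit(1) bounds by (rule first_site_small)

lemmas x2_le = second_site_le[OF orbit(1,2)]
lemmas x2_ge = second_site_ge[OF orbit(1,2)]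

lemma on_site_kink_overshoots_left: "x3 = 0.4 \<Longrightarrow> 0.375 \<le> y6"
proof -
  assume x3: "x3 = 0.4"
  have "x2 \<le> 0.128"
    by (rule x2_le[of "0.4" _ "0.083"]) (use x3 bounds x1_small nsum_0_083_ge nsum_0_128_ge in simp_all)
  moreover have "0.096 \<le> x2"
    by (rule x2_ge[of "0.4" _ "0.025"]) (use x3 bounds x1_small nsum_0_025_ge nsum_0_096_le in simp_all)
  ultimately have y4: "- 0.141 \<le> y4" "y4 \<le> - 0.1088"
    using orbit(3) x3 nsum_0_4_ge nsum_0_4_le by simp_all
  have "0.071 \<le> y5"
    using nsum_mono[OF y4(1)] nsum_0_141_le orbit(4) x3 by simp
  then show ?thesis
    using nsum_mono[of "0.071" y5] nsum_0_071_ge y4 orbit(5) by simp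
qed

lemma on_site_kink_overshoots_right: "x3 = 0.62 \<Longrightarrow> y6 \<le> - 0.375"
proof -
  assume x3: "x3 = 0.62"
  have "x2 \<le> 0.209"
    by (rule x2_le[of "0.62" _ "0.105"]) (use x3 bounds x1_small nsum_0_105_ge nsum_0_209_ge in simp_all)
  moreover have "0.167 \<le> x2"
    by (rule x2_ge[of "0.62" _ "0.008"]) (use x3 bounds x1_small nsum_0_008_ge nsum_0_167_le in simp_all)
  ultimately have y4: "- 0.187 \<le> y4" "y4 \<le> - 0.144"
    using orbit(3) x3 nsum_0_62_ge nsum_0_62_le by simp_all
  have "y5 \<le> - 0.158"
    using nsum_mono[OF y4(2)] nsum_0_144_ge orbit(4) x3 by simp
  then show ?thesis
    using nsum_mono[of y5 "- 0.158"] nsum_0_158_ge y4 orbit(5) by simp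
qed

lemma off_site_kink_overshoots_left: "x3 = 0.65 \<Longrightarrow> y6 \<le> - 0.375"
proof -
  assume x3: "x3 = 0.65"
  have "x2 \<le> 0.223"
    by (rule x2_le[of "0.65" _ "0.109"]) (use x3 bounds x1_small nsum_0_109_ge nsum_0_223_ge in simp_all)
  moreover have "0.178 \<le> x2"
    by (rule x2_ge[of "0.65" _ "0.005"]) (use x3 bounds x1_small nsum_0_005_ge nsum_0_178_le in simp_all)
  ultimately have y4: "- 0.181 \<le> y4" "y4 \<le> - 0.135"
    using orbit(3) x3 nsum_0_65_ge nsum_0_65_le by simp_all
  have "y5 \<le> - 0.158"
    using nsum_mono[OF y4(2)] nsum_0_135_ge orbit(4) x3 by simp
  then show ?thesis
    using nsum_mono[of y5 "- 0.158"] nsum_0_158_ge y4 orbit(5) by simp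
qed

text \<open>An orbit that comes back too low at site 4 is expelled downwards: it then stays low at site 5 and
  leaves the window at site 6.  This yields the lower bound on \<open>y4\<close> in a range of \<open>x3\<close> that is too
  wide for separate bounds on \<open>nsum x3\<close> and \<open>x2\<close>.\<close>

lemma low_return_is_expelled:
  assumes "0.55 \<le> x3" "x3 \<le> 0.815" "- 0.375 \<le> y6"
  shows "- 0.195 \<le> y4"
proof (rule ccontr)
  assume "\<not> - 0.195 \<le> y4"
  then have y4: "y4 \<le> - 0.195" by simp
  have "1 \<le> nsum x3" using nsum_mono[of "1/2" x3] assms by (simp add: nsum_def)
  then have y4': "- 0.375 \<le> y4" using orbit(3) bounds by simp
  have "y5 \<le> - 0.239"
    using nsum_mono[OF y4] nsum_0_195_ge orbit(4) assms by simp
  then show False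
    using nsum_mono[of y5 "- 0.239"] nsum_0_239_ge y4' orbit(5) assms by simp
qed

lemma on_site_kink_returns:
  assumes "0.4 \<le> x3" "x3 \<le> 0.62" "\<bar>y6\<bar> \<le> 0.375"
  shows "\<bar>y4\<bar> \<le> 0.195"
proof -
  have "0.096 \<le> x2"
    by (rule x2_ge[of "0.4" _ "0.025"]) (use assms bounds x1_small nsum_0_025_ge nsum_0_096_le in simp_all)
  then have "y4 \<le> 0.195"
    using orbit(3) nsum_mono[OF assms(2)] nsum_0_62_le by simp
  moreover have "- 0.195 \<le> y4"
  proof (cases "x3 \<le> 0.55")
    case True
    have "x2 \<le> 0.18"
      by (rule x2_le[of "0.55" _ "0.097"]) (use True bounds x1_small nsum_0_097_ge nsum_0_18_ge in simp_all)
    then show ?thesis using orbit(3) nsum_mono[OF assms(1)] nsum_0_4_ge by simp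
  next
    case False
    then show ?thesis using assms by (intro low_return_is_expelled) auto
  qed
  ultimately show ?thesis by simp
qed

lemma off_site_kink_returns:
  assumes "0.65 \<le> x3" "x3 \<le> 0.815" "\<bar>y6\<bar> \<le> 0.375"
  shows "\<bar>y4\<bar> \<le> 0.195"
proof -
  have "0.178 \<le> x2"
    by (rule x2_ge[of "0.65" _ "0.005"]) (use assms bounds x1_small nsum_0_005_ge nsum_0_178_le in simp_all)
  then have "y4 \<le> 0.195"
    using orbit(3) nsum_mono[OF assms(2)] nsum_0_815_le by simp
  moreover have "- 0.195 \<le> y4"
    using assms by (intro low_return_is_expelled) auto
  ultimately show ?thesis by simp
qed

lemma off_site_kink_overshoots_right: "x3 = 0.815 \<Longrightarrow> 0.375 \<le> y6"
proof -
  assume x3: "x3 = 0.815"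
  have "x2 \<le> 0.359"
    by (rule x2_le[of "0.815" _ "0.149"]) (use x3 bounds x1_small nsum_0_149_ge nsum_0_359_ge in simp_all)
  moreover have "0.178 \<le> x2"
    by (rule x2_ge[of "0.65" _ "0.005"]) (use x3 bounds x1_small nsum_0_005_ge nsum_0_178_le in simp_all)
  ultimately have y4: "- 0.022 \<le> y4" "y4 \<le> 0.195"
    using orbit(3) x3 nsum_0_815_ge nsum_0_815_le by simp_all
  \<comment> \<open>The term \<open>- y4\<close> in \<open>y6\<close> costs nothing if \<open>y4\<close> is negative; otherwise
    \<open>y5\<close> is large enough to pay for it.\<close>
  show ?thesis
  proof (cases "y4 \<le> 0")
    case True
    have "0.097 \<le> y5"
      using nsum_mono[OF y4(1)] nsum_0_022_le orbit(4) x3 by simp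
    then show ?thesis
      using nsum_mono[of "0.097" y5] nsum_0_097_ge True orbit(5) by simp
  next
    case False
    then have "0.185 \<le> y5"
      using nsum_mono[of 0 y4] orbit(4) x3 by (simp add: nsum_def)
    then show ?thesis
      using nsum_mono[of "0.185" y5] nsum_0_185_ge y4 orbit(5) by simp
  qed
qed

end

section \<open>The lifted map and its projection to the torus\<close>

text \<open>A point of the plane records two consecutive positions.\<close>

definition lift_map :: "real \<times> real \<Rightarrow> real \<times> real" where
  "lift_map p = (snd p, nsum (snd p) - fst p)"

fun site :: "nat \<Rightarrow> real \<times> real \<Rightarrow> real" where
  "site 0 p = fst p"
| "site (Suc 0) p = snd p"
| "site (Suc (Suc n)) p = nsum (site (Suc n) p) - site n p"

definition torus_point :: "real \<times> real \<Rightarrow> torus" where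
  "torus_point p = to_torus (snd p, snd p - fst p)"

lemma lift_map_funpow: "(lift_map ^^ n) p = (site n p, site (Suc n) p)"
  by (induction n) (simp_all add: lift_map_def)

lemma standard_map_torus_point: "standard_map 2 (torus_point p) = torus_point (lift_map p)"
  by (simp add: torus_point_def standard_map.abs_eq lift_map_def nsum_def algebra_simps)

lemma standard_map_funpow_torus_point: "(standard_map 2 ^^ n) (torus_point p) = torus_point ((lift_map ^^ n) p)"
  by (induction n) (simp_all add: standard_map_torus_point)

definition shift :: "int \<Rightarrow> real \<times> real \<Rightarrow> real \<times> real" where
  "shift m p = (fst p - of_int m, snd p - of_int m)"

lemma torus_point_shift: "torus_point (shift m p) = torus_point p"
  by (simp add: torus_point_def shift_def to_torus_eq_iff torus_rel_def)

lemma nsum_diff_int: "nsum (x - of_int m) = nsum x - 2 * of_int m"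
proof -
  have "sin (2 * pi * (x - of_int m)) = sin (2 * pi * x)"
    by (simp add: right_diff_distrib sin_diff)
  then show ?thesis by (simp add: nsum_def)
qed

lemma site_shift: "site n (shift m p) = site n p - of_int m"
  by (induction n p rule: site.induct) (simp_all add: shift_def nsum_diff_int)

lemma site_minus: "site n (- p) = - site n p"
  by (induction n p rule: site.induct) simp_all

lemma site_add: "site n (site k p, site (Suc k) p) = site (n + k) p"
  by (induction n p rule: site.induct) simp_all

lemma continuous_on_site [continuous_intros]:
  "continuous_on A f \<Longrightarrow> continuous_on A (\<lambda>t. site n (f t))"
proof (induction n "(0, 0) :: real \<times> real" rule: site.induct)
qed (auto intro!: continuous_intros)

text \<open>Following a kink for \<open>n\<close> steps leads to a neighbourhood of the integer \<open>m\<close>; the translation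
  brings it back to 0 and is invisible on the torus.\<close>

definition advance :: "nat \<Rightarrow> int \<Rightarrow> real \<times> real \<Rightarrow> real \<times> real" where
  "advance n m p = shift m ((lift_map ^^ n) p)"

lemma site_advance: "site k (advance n m p) = site (k + n) p - of_int m"
  by (simp add: advance_def site_shift lift_map_funpow site_add)

lemma torus_point_advance: "torus_point (advance n m p) = (standard_map 2 ^^ n) (torus_point p)"
  by (simp add: advance_def torus_point_shift standard_map_funpow_torus_point)

lemma continuous_on_advance:
  "continuous_on A f \<Longrightarrow> continuous_on A (\<lambda>t. advance n m (f t))"
  unfolding advance_def shift_def lift_map_funpow by (auto intro!: continuous_intros)

section \<open>Transverse paths\<close>

definition traverses :: "(real \<Rightarrow> real) \<Rightarrow> real \<Rightarrow> real \<Rightarrow> real \<Rightarrow> real \<Rightarrow> bool" where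
  "traverses \<phi> a b l h \<longleftrightarrow> (\<forall>t\<in>{a..b}. \<phi> t \<in> {l..h}) \<and> (\<phi> a = l \<and> \<phi> b = h \<or> \<phi> a = h \<and> \<phi> b = l)"

lemma traverses_bounds: "traverses \<phi> a b l h \<Longrightarrow> t \<in> {a..b} \<Longrightarrow> l \<le> \<phi> t \<and> \<phi> t \<le> h"
  by (auto simp: traverses_def)

text \<open>Start at the last time with \<open>\<phi> \<le> l\<close> and stop at the first later time with \<open>\<phi> \<ge> h\<close>.\<close>

lemma traverses_sub_up:
  fixes \<phi> :: "real \<Rightarrow> real"
  assumes cont: "continuous_on {a..b} \<phi>" and "a \<le> b" "\<phi> a \<le> l" "h \<le> \<phi> b" "l \<le> h"
  shows "\<exists>c d. a \<le> c \<and> c \<le> d \<and> d \<le> b \<and> traverses \<phi> c d l h"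
proof -
  have compact: "compact ({x..b} \<inter> \<phi> -` S)" if "closed S" "continuous_on {x..b} \<phi>" for x S
  proof -
    have "closed ({x..b} \<inter> \<phi> -` S)"
      using that by (intro continuous_closed_preimage) auto
    then have "compact ({x..b} \<inter> ({x..b} \<inter> \<phi> -` S))" by (intro compact_Int_closed) auto
    then show ?thesis by simp
  qed
  have "{a..b} \<inter> \<phi> -` {..l} \<noteq> {}" using assms by auto
  from compact_attains_sup[OF compact[OF _ cont] this] obtain c
    where c: "c \<in> {a..b}" "\<phi> c \<le> l"
      and c_last: "\<And>t. t \<in> {a..b} \<Longrightarrow> \<phi> t \<le> l \<Longrightarrow> t \<le> c"
    by auto
  have cont_c: "continuous_on {c..b} \<phi>" using cont c by (auto intro: continuous_on_subset)
  obtain t where "c \<le> t" "t \<le> b" "\<phi> t = l"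
    using IVT'[of \<phi> c l b] c cont_c assms by auto
  then have phi_c: "\<phi> c = l" using c_last[of t] c by auto
  have "{c..b} \<inter> \<phi> -` {h..} \<noteq> {}" using assms c by auto
  from compact_attains_inf[OF compact[OF _ cont_c] this] obtain d
    where d: "d \<in> {c..b}" "h \<le> \<phi> d"
      and d_first: "\<And>t. t \<in> {c..b} \<Longrightarrow> h \<le> \<phi> t \<Longrightarrow> d \<le> t"
    by auto
  obtain t where "c \<le> t" "t \<le> d" "\<phi> t = h"
    using IVT'[of \<phi> c h d] c d phi_c assms continuous_on_subset[OF cont_c, of "{c..d}"] by auto
  then have phi_d: "\<phi> d = h" using d_first[of t] d by auto
  have "\<phi> t \<in> {l..h}" if t: "t \<in> {c..d}" for t
  proof -
    have "l \<le> \<phi> t"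
    proof (rule ccontr)
      assume "\<not> l \<le> \<phi> t"
      then have "t = c" using c_last[of t] t c d by auto
      then show False using \<open>\<not> l \<le> \<phi> t\<close> phi_c by simp
    qed
    moreover have "\<phi> t \<le> h"
    proof (rule ccontr)
      assume "\<not> \<phi> t \<le> h"
      then have "t = d" using d_first[of t] t d by auto
      then show False using \<open>\<not> \<phi> t \<le> h\<close> phi_d by simp
    qed
    ultimately show ?thesis by simp
  qed
  then show ?thesis
    using c d phi_c phi_d by (intro exI[of _ c] exI[of _ d]) (auto simp: traverses_def)
qed

lemma traverses_sub:
  fixes \<phi> :: "real \<Rightarrow> real"
  assumes cont: "continuous_on {a..b} \<phi>" and "a \<le> b" "l \<le> h"
    and ends: "\<phi> a \<le> l \<and> h \<le> \<phi> b \<or> h \<le> \<phi> a \<and> \<phi> b \<le> l"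
  obtains c d where "a \<le> c" "c \<le> d" "d \<le> b" "traverses \<phi> c d l h"
proof (cases "\<phi> a \<le> l \<and> h \<le> \<phi> b")
  case True
  then show ?thesis using traverses_sub_up[of a b \<phi> l h] assms that by blast
next
  case False
  then obtain c d where "a \<le> c" "c \<le> d" "d \<le> b" "traverses (\<lambda>t. - \<phi> t) c d (- h) (- l)"
    using traverses_sub_up[of a b "\<lambda>t. - \<phi> t" "- h" "- l"] assms by (auto intro: continuous_intros)
  then show ?thesis by (intro that[of c d]) (auto simp: traverses_def)
qed

definition window :: "real \<times> real \<Rightarrow> bool" where
  "window p \<longleftrightarrow> \<bar>site 0 p\<bar> \<le> 0.195 \<and> \<bar>site 2 p\<bar> \<le> 0.375"

definition transverse :: "(real \<Rightarrow> real \<times> real) \<Rightarrow> real \<Rightarrow> real \<Rightarrow> bool" where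
  "transverse \<gamma> a b \<longleftrightarrow> a \<le> b \<and> continuous_on {a..b} \<gamma> \<and> (\<forall>t\<in>{a..b}. window (\<gamma> t)) \<and>
     traverses (\<lambda>t. site 2 (\<gamma> t)) a b (- 0.375) 0.375"

lemma site_rec:
  "nsum (site 1 p) = site 0 p + site 2 p" "nsum (site 2 p) = site 1 p + site 3 p"
  "site 4 p = nsum (site 3 p) - site 2 p" "site 5 p = nsum (site 4 p) - site 3 p"
  "site 6 p = nsum (site 5 p) - site 4 p"
  by (simp_all add: numeral_eq_Suc)

lemma window_site1: "window p \<Longrightarrow> \<bar>site 1 p\<bar> \<le> 0.155"
  by (rule first_site_small[OF site_rec(1)]) (auto simp: window_def)

lemma window_minus: "window (- p) \<longleftrightarrow> window p"
  by (simp add: window_def site_minus)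

lemma site3_at_top:
  assumes "window p" "site 2 p = 0.375"
  shows "0.815 \<le> site 3 p"
  using window_site1[OF assms(1)] site_rec(2)[of p] assms(2) nsum_0_375_ge by (simp del: site.simps)

lemma site3_at_bottom: "window p \<Longrightarrow> site 2 p = - 0.375 \<Longrightarrow> site 3 p \<le> - 0.815"
  using site3_at_top[of "- p"] by (simp add: window_minus site_minus)

text \<open>A range \<open>{l..h}\<close> of site 3 is a gate if the excursion of \<open>n\<close> steps to \<open>m\<close> carries it across the
  window: at its two ends the excursion overshoots the window on opposite sides, and in
  between it meets the bound on the first coordinate of the window whenever it meets the other one.
  The bound \<open>0.815\<close> makes sure that every transverse path runs through the whole gate.\<close>

definition gate :: "real \<Rightarrow> real \<Rightarrow> nat \<Rightarrow> int \<Rightarrow> bool" where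
  "gate l h n m \<longleftrightarrow> - 0.815 \<le> l \<and> l \<le> h \<and> h \<le> 0.815 \<and>
     ((\<forall>p. window p \<and> site 3 p = l \<longrightarrow> site (n + 2) p - m \<le> - 0.375) \<and>
      (\<forall>p. window p \<and> site 3 p = h \<longrightarrow> 0.375 \<le> site (n + 2) p - m) \<or>
      (\<forall>p. window p \<and> site 3 p = l \<longrightarrow> 0.375 \<le> site (n + 2) p - m) \<and>
      (\<forall>p. window p \<and> site 3 p = h \<longrightarrow> site (n + 2) p - m \<le> - 0.375)) \<and>
     (\<forall>p. window p \<and> site 3 p \<in> {l..h} \<and> \<bar>site (n + 2) p - m\<bar> \<le> 0.375 \<longrightarrow> \<bar>site n p - m\<bar> \<le> 0.195)"

lemma gate_cross:
  assumes "gate l h n m" "window p" "window q" "site 3 p = l" "site 3 q = h"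
  shows "site (n + 2) p - m \<le> - 0.375 \<and> 0.375 \<le> site (n + 2) q - m \<or>
         0.375 \<le> site (n + 2) p - m \<and> site (n + 2) q - m \<le> - 0.375"
  using assms unfolding gate_def by blast

lemma gate_minus:
  assumes "gate l h n m"
  shows "gate (- h) (- l) n (- m)"
proof -
  have flip: "(\<forall>p. P p) \<longleftrightarrow> (\<forall>p. P (- p))" for P :: "real \<times> real \<Rightarrow> bool"
    by (metis minus_minus)
  have 1: "- x - real_of_int (- m) \<le> - 0.375 \<longleftrightarrow> 0.375 \<le> x - m"
     "0.375 \<le> - x - real_of_int (- m) \<longleftrightarrow> x - m \<le> - 0.375"
     "\<bar>- x - real_of_int (- m)\<bar> = \<bar>x - m\<bar>" for x by auto
  have 2: "- x = - l \<longleftrightarrow> x = l" "- x = - h \<longleftrightarrow> x = h" "- x \<in> {- h..- l} \<longleftrightarrow> x \<in> {l..h}" for x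
    by auto
  show ?thesis
    using assms unfolding gate_def
    apply (subst (1 2 3 4 5) flip)
    unfolding window_minus site_minus 1 2
    by (simp add: conj_ac disj_ac)
qed

text \<open>The excursion of length 1 that stays near the fixed point.\<close>

lemma gate_identity: "gate (- 0.375) 0.375 1 0"
proof -
  have *: "site (1 + 2) p = site 3 p" for p by (simp add: numeral_eq_Suc)
  show ?thesis
    unfolding gate_def * using window_site1 by force
qed

lemma gate_on_site_kink: "gate 0.4 0.62 4 1"
proof -
  have eqs: "site 4 p - 1 = nsum (site 3 p) - site 2 p - 1"
     "site 5 p - 1 = nsum (site 4 p - 1) - site 3 p + 1"
     "site 6 p - 1 = nsum (site 5 p - 1) - (site 4 p - 1)" for p
    using nsum_diff_int[of _ 1] site_rec[of p] by simp_all
  have w: "\<bar>site 0 p\<bar> \<le> 0.195" "\<bar>site 2 p\<bar> \<le> 0.375" if "window p" for p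
    using that by (auto simp: window_def)
  have six: "4 + 2 = (6::nat)" by simp
  have left: "window p \<and> site 3 p = 0.4 \<longrightarrow> 0.375 \<le> site 6 p - 1"
    and right: "window p \<and> site 3 p = 0.62 \<longrightarrow> site 6 p - 1 \<le> - 0.375" for p
    using on_site_kink_overshoots_left[OF site_rec(1,2) eqs w] on_site_kink_overshoots_right[OF site_rec(1,2) eqs w] by blast+
  have exit: "window p \<and> site 3 p \<in> {0.4..0.62} \<and> \<bar>site 6 p - 1\<bar> \<le> 0.375 \<longrightarrow> \<bar>site 4 p - 1\<bar> \<le> 0.195" for p
    using on_site_kink_returns[OF site_rec(1,2) eqs w, of p] by simp
  show ?thesis
    unfolding gate_def six of_int_1
    by (intro conjI disjI2 allI left right exit) simp_all
qed

lemma gate_off_site_kink: "gate 0.65 0.815 4 1"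
proof -
  have eqs: "site 4 p - 1 = nsum (site 3 p) - site 2 p - 1"
     "site 5 p - 1 = nsum (site 4 p - 1) - site 3 p + 1"
     "site 6 p - 1 = nsum (site 5 p - 1) - (site 4 p - 1)" for p
    using nsum_diff_int[of _ 1] site_rec[of p] by simp_all
  have w: "\<bar>site 0 p\<bar> \<le> 0.195" "\<bar>site 2 p\<bar> \<le> 0.375" if "window p" for p
    using that by (auto simp: window_def)
  have six: "4 + 2 = (6::nat)" by simp
  have left: "window p \<and> site 3 p = 0.65 \<longrightarrow> site 6 p - 1 \<le> - 0.375"
    and right: "window p \<and> site 3 p = 0.815 \<longrightarrow> 0.375 \<le> site 6 p - 1" for p
    using off_site_kink_overshoots_left[OF site_rec(1,2) eqs w] off_site_kink_overshoots_right[OF site_rec(1,2) eqs w] by blast+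
  have exit: "window p \<and> site 3 p \<in> {0.65..0.815} \<and> \<bar>site 6 p - 1\<bar> \<le> 0.375 \<longrightarrow> \<bar>site 4 p - 1\<bar> \<le> 0.195" for p
    using off_site_kink_returns[OF site_rec(1,2) eqs w, of p] by simp
  show ?thesis
    unfolding gate_def six of_int_1
    by (intro conjI disjI1 allI left right exit) simp_all
qed

text \<open>The first subpath runs through the gate, the second one is cut out of it such that its image runs
  through the window; both exist by the intermediate value theorem.\<close>

lemma gate_passage:
  assumes \<gamma>: "transverse \<gamma> a b" and gate: "gate l h n m"
  obtains c d where "{c..d} \<subseteq> {a..b}" "\<And>t. t \<in> {c..d} \<Longrightarrow> site 3 (\<gamma> t) \<in> {l..h}"
    "transverse (\<lambda>t. advance n m (\<gamma> t)) c d"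
proof -
  have ab: "a \<le> b" and cont: "continuous_on {a..b} \<gamma>"
    and win: "\<And>t. t \<in> {a..b} \<Longrightarrow> window (\<gamma> t)"
    and trav: "site 2 (\<gamma> a) = - 0.375 \<and> site 2 (\<gamma> b) = 0.375 \<or>
               site 2 (\<gamma> a) = 0.375 \<and> site 2 (\<gamma> b) = - 0.375"
    using \<gamma> by (auto simp: transverse_def traverses_def)
  have lh: "- 0.815 \<le> l" "l \<le> h" "h \<le> 0.815" using gate by (auto simp: gate_def)
  have "site 3 (\<gamma> a) \<le> l \<and> h \<le> site 3 (\<gamma> b) \<or> h \<le> site 3 (\<gamma> a) \<and> site 3 (\<gamma> b) \<le> l"
    using trav site3_at_top[OF win] site3_at_bottom[OF win] lh ab by fastforce
  then obtain a' b' where ab': "a \<le> a'" "a' \<le> b'" "b' \<le> b"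
    and trav': "traverses (\<lambda>t. site 3 (\<gamma> t)) a' b' l h"
    using traverses_sub[of a b "\<lambda>t. site 3 (\<gamma> t)" l h] cont ab lh
    by (auto intro: continuous_on_site)
  let ?q = "\<lambda>t. advance n m (\<gamma> t)"
  have ends: "site 3 (\<gamma> a') = l \<and> site 3 (\<gamma> b') = h \<or> site 3 (\<gamma> a') = h \<and> site 3 (\<gamma> b') = l"
    and range: "\<And>t. t \<in> {a'..b'} \<Longrightarrow> site 3 (\<gamma> t) \<in> {l..h}"
    using trav' by (auto simp: traverses_def)
  have site2: "site 2 (?q t) = site (n + 2) (\<gamma> t) - m" and site0: "site 0 (?q t) = site n (\<gamma> t) - m" for t
    by (simp_all add: site_advance add.commute)
  have win': "window (\<gamma> a')" "window (\<gamma> b')" using win ab' by auto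
  have cont': "continuous_on {a'..b'} ?q"
    using cont ab' by (intro continuous_on_advance) (auto intro: continuous_on_subset)
  have cross: "site 2 (?q a') \<le> - 0.375 \<and> 0.375 \<le> site 2 (?q b') \<or>
      0.375 \<le> site 2 (?q a') \<and> site 2 (?q b') \<le> - 0.375"
    using ends gate_cross[OF gate win'] gate_cross[OF gate win'(2,1)] unfolding site2 by blast
  have "- 0.375 \<le> (0.375 :: real)" by simp
  from traverses_sub[OF continuous_on_site[OF cont', of 2] ab'(2) this cross]
  obtain c d where cd: "a' \<le> c" "c \<le> d" "d \<le> b'"
    and trav'': "traverses (\<lambda>t. site 2 (?q t)) c d (- 0.375) 0.375"
    by blast
  have "window (?q t)" if t: "t \<in> {c..d}" for t
  proof -
    have "\<bar>site 2 (?q t)\<bar> \<le> 0.375"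
      using traverses_bounds[OF trav'' t] by (intro abs_leI) simp_all
    moreover have "window (\<gamma> t)" "site 3 (\<gamma> t) \<in> {l..h}"
      using t cd ab' win range by auto
    ultimately show ?thesis
      using gate unfolding gate_def window_def site2 site0 by blast
  qed
  then have "transverse ?q c d"
    using cd cont' trav'' by (auto simp: transverse_def intro: continuous_on_subset)
  then show ?thesis using cd ab' range by (intro that[of c d]) auto
qed

section \<open>Separation on the torus\<close>

text \<open>The window has diameter less than 1, hence two of its points that are close on the torus are close
  in the plane.  As \<open>nsum\<close> is 4-Lipschitz, a distance below \<open>1/1000\<close> on the torus leaves less
  than \<open>6/1000\<close> at site 2 and less than \<open>25/1000\<close> at site 3.\<close>

lemma torus_point_separated:
  assumes win: "window p" "window q" and far: "0.025 \<le> \<bar>site 3 p - site 3 q\<bar>"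
  shows "1/2000 < dist (torus_point p) (torus_point q)"
proof -
  have "1/1000 \<le> dist (torus_point p) (torus_point q)"
    unfolding dist_torus_def
  proof (rule le_setdistI)
    fix x y assume x: "x \<in> torus_fibre (torus_point p)" and y: "y \<in> torus_fibre (torus_point q)"
    obtain u v u' v' where pq: "p = (u, v)" "q = (u', v')" by fastforce
    obtain i j :: int where ij: "fst x = v + i" "snd x = v - u + j"
      using x by (auto simp: pq torus_point_def torus_fibre_to_torus torus_rel_def algebra_simps elim!: Ints_cases)
    obtain i' j' :: int where ij': "fst y = v' + i'" "snd y = v' - u' + j'"
      using y by (auto simp: pq torus_point_def torus_fibre_to_torus torus_rel_def algebra_simps elim!: Ints_cases)
    show "1/1000 \<le> dist x y"
    proof (rule ccontr)
      assume "\<not> 1/1000 \<le> dist x y"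
      then have close: "\<bar>fst x - fst y\<bar> < 1/1000" "\<bar>snd x - snd y\<bar> < 1/1000"
        using dist_fst_le[of x y] dist_snd_le[of x y] by (auto simp: dist_real_def)
      have b: "\<bar>u\<bar> \<le> 1/5" "\<bar>u'\<bar> \<le> 1/5" "\<bar>v\<bar> \<le> 1/5" "\<bar>v'\<bar> \<le> 1/5"
        using win window_site1[of p] window_site1[of q] by (auto simp: window_def pq)
      have "real_of_int i < real_of_int i' + 1" "real_of_int i' < real_of_int i + 1"
        "real_of_int j < real_of_int j' + 1" "real_of_int j' < real_of_int j + 1"
        using close b unfolding ij ij' abs_less_iff abs_le_iff by linarith+
      then have "i = i'" "j = j'" by linarith+
      then have uv: "\<bar>v - v'\<bar> < 1/1000" "\<bar>u - u'\<bar> < 2/1000"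
        using close unfolding ij ij' by linarith+
      have 2: "site 2 p = nsum v - u" "site 2 q = nsum v' - u'"
        "site 3 p = nsum (site 2 p) - v" "site 3 q = nsum (site 2 q) - v'"
        by (simp_all add: pq numeral_eq_Suc)
      have "\<bar>nsum v - nsum v'\<bar> < 4/1000"
        using nsum_lipschitz[of v v'] uv(1) by simp
      then have "\<bar>site 2 p - site 2 q\<bar> < 6/1000"
        using uv(2) unfolding 2 abs_less_iff by linarith
      then have "\<bar>nsum (site 2 p) - nsum (site 2 q)\<bar> < 24/1000"
        using nsum_lipschitz[of "site 2 p" "site 2 q"] by simp
      then have "\<bar>site 3 p - site 3 q\<bar> < 25/1000"
        using uv(1) unfolding 2(3,4) abs_less_iff by linarith
      then show False using far by simp
    qed
  qed (use torus_fibre_ne in auto)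
  then show ?thesis by simp
qed

section \<open>Counting separated orbits\<close>

definition gates :: "(real \<times> real \<times> nat \<times> int) set" where
  "gates = {(- 0.375, 0.375, 1, 0), (0.4, 0.62, 4, 1), (0.65, 0.815, 4, 1),
            (- 0.62, - 0.4, 4, - 1), (- 0.815, - 0.65, 4, - 1)}"

lemma gates_gate: "(l, h, n, m) \<in> gates \<Longrightarrow> gate l h n m"
  unfolding gates_def insert_iff prod.inject empty_iff
  using gate_identity gate_on_site_kink gate_off_site_kink gate_minus[OF gate_on_site_kink]
    gate_minus[OF gate_off_site_kink] by metis

lemma gates_apart:
  assumes "(l, h, n, m) \<in> gates" "(l', h', n', m') \<in> gates" "(l, h, n, m) \<noteq> (l', h', n', m')"
    "x \<in> {l..h}" "y \<in> {l'..h'}"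
  shows "0.025 \<le> \<bar>x - y\<bar>"
  using assms unfolding gates_def by auto

definition resolved :: "nat \<Rightarrow> torus \<Rightarrow> torus \<Rightarrow> bool" where
  "resolved N P Q \<longleftrightarrow> (\<exists>k<N. 1/2000 < dist ((standard_map 2 ^^ k) P) ((standard_map 2 ^^ k) Q))"

text \<open>Each gate contributes the points obtained by induction from the path behind it.  Points from
  different gates are resolved at time 0, points from the same gate after the excursion.
  The factor \<open>1.7 ^ 3\<close> covers the times \<open>N \<le> 3\<close>, for which there is only a single point.\<close>

lemma transverse_resolved_points:
  assumes "transverse \<gamma> a b"
  shows "\<exists>T \<subseteq> {a..b}. finite T \<and> 1.7 ^ N \<le> 1.7 ^ 3 * real (card T) \<and>
    (\<forall>s\<in>T. \<forall>t\<in>T. s \<noteq> t \<longrightarrow> resolved N (torus_point (\<gamma> s)) (torus_point (\<gamma> t)))"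
  using assms
proof (induction N arbitrary: \<gamma> a b rule: less_induct)
  case (less N)
  have ab: "a \<le> b" and win: "\<And>t. t \<in> {a..b} \<Longrightarrow> window (\<gamma> t)"
    using less.prems by (auto simp: transverse_def)
  show ?case
  proof (cases "N \<le> 3")
    case True
    then have "(1.7::real) ^ N \<le> 1.7 ^ 3" by (intro power_increasing) auto
    then show ?thesis using ab by (intro exI[of _ "{a}"]) auto
  next
    case False
    then have N: "4 \<le> N" by simp
    have gate_time: "1 \<le> n" "n \<le> 4" if "(l, h, n, m) \<in> gates" for l h n m
      using that by (auto simp: gates_def)
    define good where "good = (\<lambda>(l, h, n, m :: int) T. T \<subseteq> {a..b} \<and> finite T \<and>
        1.7 ^ (N - n) \<le> 1.7 ^ 3 * real (card T) \<and> (\<forall>t\<in>T. site 3 (\<gamma> t) \<in> {l..h}) \<and>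
        (\<forall>s\<in>T. \<forall>t\<in>T. s \<noteq> t \<longrightarrow> resolved N (torus_point (\<gamma> s)) (torus_point (\<gamma> t))))"
    have "\<exists>T. good (l, h, n, m) T" if e: "(l, h, n, m) \<in> gates" for l h n m
    proof -
      obtain c d where cd: "{c..d} \<subseteq> {a..b}" "\<And>t. t \<in> {c..d} \<Longrightarrow> site 3 (\<gamma> t) \<in> {l..h}"
        "transverse (\<lambda>t. advance n m (\<gamma> t)) c d"
        using gate_passage[OF less.prems gates_gate[OF e]] by blast
      have "N - n < N" using gate_time[OF e] N by simp
      from less.IH[OF this cd(3)] obtain T where T: "T \<subseteq> {c..d}" "finite T"
        "1.7 ^ (N - n) \<le> 1.7 ^ 3 * real (card T)"
        "\<And>s t. s \<in> T \<Longrightarrow> t \<in> T \<Longrightarrow> s \<noteq> t \<Longrightarrow>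
           resolved (N - n) ((standard_map 2 ^^ n) (torus_point (\<gamma> s))) ((standard_map 2 ^^ n) (torus_point (\<gamma> t)))"
        unfolding torus_point_advance by blast
      have "resolved N P Q" if "resolved (N - n) ((standard_map 2 ^^ n) P) ((standard_map 2 ^^ n) Q)" for P Q
        using that unfolding resolved_def funpow_add[THEN fun_cong, unfolded o_apply, symmetric]
        by (metis less_diff_conv)
      then show ?thesis
        unfolding good_def case_prod_conv using T(2-) cd(2) T(1) order_trans[OF T(1) cd(1)]
        by (intro exI[of _ T]) blast
    qed
    then have "\<forall>e\<in>gates. \<exists>T. good e T" by auto
    from bchoice[OF this] obtain T where good: "\<And>e. e \<in> gates \<Longrightarrow> good e (T e)" by blast
    then have T: "T e \<subseteq> {a..b}" "finite (T e)"
      "1.7 ^ (N - fst (snd (snd e))) \<le> 1.7 ^ 3 * real (card (T e))"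
      "\<And>t. t \<in> T e \<Longrightarrow> site 3 (\<gamma> t) \<in> {fst e..fst (snd e)}"
      "\<And>s t. s \<in> T e \<Longrightarrow> t \<in> T e \<Longrightarrow> s \<noteq> t \<Longrightarrow> resolved N (torus_point (\<gamma> s)) (torus_point (\<gamma> t))"
      if "e \<in> gates" for e
      using that unfolding good_def by (fastforce simp: case_prod_beta)+
    have apart: "0.025 \<le> \<bar>site 3 (\<gamma> s) - site 3 (\<gamma> t)\<bar>"
      if "e \<in> gates" "e' \<in> gates" "e \<noteq> e'" "s \<in> T e" "t \<in> T e'" for e e' s t
      using gates_apart[of "fst e" "fst (snd e)" "fst (snd (snd e))" "snd (snd (snd e))"
          "fst e'" "fst (snd e')" "fst (snd (snd e'))" "snd (snd (snd e'))"] T(4) that by simp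
    have fin: "finite gates" by (simp add: gates_def)
    have disj: "\<forall>e\<in>gates. \<forall>e'\<in>gates. e \<noteq> e' \<longrightarrow> T e \<inter> T e' = {}"
    proof (intro ballI impI)
      fix e e' assume e: "e \<in> gates" "e' \<in> gates" "e \<noteq> e'"
      show "T e \<inter> T e' = {}" using apart[OF e] by fastforce
    qed
    have "(1.7::real) ^ N \<le> 1.7 ^ (N - 1) + 4 * 1.7 ^ (N - 4)"
    proof -
      obtain M where M: "N = M + 4" using N by (metis add.commute le_iff_add)
      have "(1.7::real) ^ 4 * 1.7 ^ M \<le> (1.7 ^ 3 + 4) * 1.7 ^ M"
        by (intro mult_right_mono) (simp_all add: power_divide)
      then show ?thesis by (simp add: M power_add algebra_simps)
    qed
    also have "\<dots> = (\<Sum>e\<in>gates. 1.7 ^ (N - fst (snd (snd e))))"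
      by (simp add: gates_def)
    also have "\<dots> \<le> (\<Sum>e\<in>gates. 1.7 ^ 3 * real (card (T e)))"
      by (intro sum_mono T(3))
    also have "\<dots> = 1.7 ^ 3 * real (card (\<Union>e\<in>gates. T e))"
      using card_UN_disjoint[OF fin _ disj] T(2) by (simp add: sum_distrib_left)
    finally have card: "1.7 ^ N \<le> 1.7 ^ 3 * real (card (\<Union>e\<in>gates. T e))" .
    have "resolved N (torus_point (\<gamma> s)) (torus_point (\<gamma> t))"
      if st: "s \<in> (\<Union>e\<in>gates. T e)" "t \<in> (\<Union>e\<in>gates. T e)" "s \<noteq> t" for s t
    proof -
      obtain e e' where e: "e \<in> gates" "s \<in> T e" "e' \<in> gates" "t \<in> T e'" using st by blast
      show ?thesis
      proof (cases "e = e'")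
        case True
        then show ?thesis using T(5) e st by blast
      next
        case False
        have "1/2000 < dist (torus_point (\<gamma> s)) (torus_point (\<gamma> t))"
          using T(1)[OF e(1)] T(1)[OF e(3)] e False
          by (intro torus_point_separated win apart[of e e']) blast+
        then show ?thesis
          unfolding resolved_def using N by (intro exI[of _ 0]) simp
      qed
    qed
    then show ?thesis
      using card T(1,2) fin by (intro exI[of _ "\<Union>e\<in>gates. T e"]) blast
  qed
qed

lemma transverse_exists: "\<exists>\<gamma> a b. transverse \<gamma> a b"
proof -
  have cont: "continuous_on {- (1/2)..1/2} (\<lambda>t. site 2 (0, t))"
    by (intro continuous_on_site continuous_intros)
  have two: "site 2 (0, t) = nsum t" for t by (simp add: numeral_eq_Suc)
  have "site 2 (0, - (1/2)) \<le> - 0.375 \<and> 0.375 \<le> site 2 (0, 1/2)"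
    unfolding two by (simp add: nsum_def)
  then obtain c d where cd: "- (1/2) \<le> c" "c \<le> d" "d \<le> 1/2"
    and trav: "traverses (\<lambda>t. site 2 (0, t)) c d (- 0.375) 0.375"
    using traverses_sub_up[OF cont, of "- 0.375" "0.375"] by auto
  have "window (0, t)" if "t \<in> {c..d}" for t
  proof -
    have "\<bar>site 2 (0, t)\<bar> \<le> 0.375"
      using traverses_bounds[OF trav that] by (intro abs_leI) simp_all
    then show ?thesis by (simp add: window_def)
  qed
  then have "transverse (\<lambda>t. (0, t)) c d"
    using cd trav by (auto simp: transverse_def intro!: continuous_intros)
  then show ?thesis by blast
qed

lemma max_separated_standard_map_ge:
  "1.7 ^ N \<le> 1.7 ^ 3 * real (max_separated UNIV (standard_map 2) N (1/2000))"
proof -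
  obtain \<gamma> a b where "transverse \<gamma> a b" using transverse_exists by blast
  from transverse_resolved_points[OF this, of N] obtain T where T: "finite T"
    "1.7 ^ N \<le> 1.7 ^ 3 * real (card T)"
    "\<And>s t. s \<in> T \<Longrightarrow> t \<in> T \<Longrightarrow> s \<noteq> t \<Longrightarrow> resolved N (torus_point (\<gamma> s)) (torus_point (\<gamma> t))"
    by blast
  have "inj_on (\<lambda>t. torus_point (\<gamma> t)) T"
    using T(3) by (fastforce simp: inj_on_def resolved_def)
  then have "card ((\<lambda>t. torus_point (\<gamma> t)) ` T) = card T" by (rule card_image)
  moreover have "separated UNIV (standard_map 2) N (1/2000) ((\<lambda>t. torus_point (\<gamma> t)) ` T)"
    unfolding separated_def using T(3) by (auto simp: resolved_def)
  then have "card ((\<lambda>t. torus_point (\<gamma> t)) ` T) \<le> max_separated UNIV (standard_map 2) N (1/2000)"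
    by (intro max_separated_attained(2) compact_torus continuous_on_standard_map) auto
  ultimately show ?thesis using T(2) by (simp add: order_trans[OF _ mult_left_mono])
qed

text \<open>The constant \<open>C\<close> disappears in the limit since \<open>ln C / n\<close> tends to 0.\<close>

lemma topological_entropy_ge_ln:
  fixes f :: "'a::metric_space \<Rightarrow> 'a"
  assumes "0 < \<delta>" "1 \<le> \<mu>" "0 < C" and growth: "\<And>n. \<mu> ^ n \<le> C * real (max_separated X f n \<delta>)"
  shows "ereal (ln \<mu>) \<le> topological_entropy X f"
proof -
  define r where "r = (\<lambda>n. ln (real (max_separated X f n \<delta>)) / real n)"
  have "ln \<mu> - ln C / real n \<le> r n" if "1 \<le> n" for n
  proof -
    have pos: "0 < real (max_separated X f n \<delta>)"
      using growth[of n] assms zero_less_power[of \<mu> n] by (smt (verit) mult_nonneg_nonpos)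
    have "real n * ln \<mu> = ln (\<mu> ^ n)" using assms by (simp add: ln_realpow)
    also have "\<dots> \<le> ln (C * real (max_separated X f n \<delta>))"
      using growth[of n] assms pos by (intro ln_mono) auto
    also have "\<dots> = ln C + ln (real (max_separated X f n \<delta>))"
      using assms pos by (intro ln_mult_pos) auto
    finally have "ln \<mu> \<le> (ln C + ln (real (max_separated X f n \<delta>))) / real n"
      using that by (simp add: pos_le_divide_eq mult.commute)
    then show ?thesis by (simp add: r_def add_divide_distrib)
  qed
  then have "eventually (\<lambda>n. ereal (ln \<mu> - ln C / real n) \<le> ereal (r n)) sequentially"
    by (auto intro: eventually_sequentiallyI[of 1])
  then have "limsup (\<lambda>n. ereal (ln \<mu> - ln C / real n)) \<le> limsup (\<lambda>n. ereal (r n))"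
    by (rule Limsup_mono)
  moreover have "(\<lambda>n. ln \<mu> - ln C / real n) \<longlonglongrightarrow> ln \<mu> - 0"
    by (intro tendsto_intros lim_const_over_n)
  then have "limsup (\<lambda>n. ereal (ln \<mu> - ln C / real n)) = ereal (ln \<mu>)"
    by (intro lim_imp_Limsup) auto
  ultimately have "ereal (ln \<mu>) \<le> limsup (\<lambda>n. ereal (r n))" by simp
  then show ?thesis
    unfolding topological_entropy_def r_def using assms(1) by (intro SUP_upper2[of \<delta>]) auto
qed

lemma ln_1_7: "0.44722970117798 \<le> ln (1.7::real)"
proof -
  have "exp (0.45::real) \<le> 1 + 0.45 + 0.45\<^sup>2" by (rule exp_bound) auto
  also have "\<dots> \<le> 1.7" by (simp add: power2_eq_square)
  finally have "0.45 \<le> ln (1.7::real)" by (subst ln_ge_iff) auto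
  then show ?thesis by simp
qed

theorem theorem4p3:
  shows "topological_entropy UNIV (standard_map 2) \<ge> ereal 0.44722970117798"
proof -
  have "ereal (ln 1.7) \<le> topological_entropy UNIV (standard_map 2)"
    by (rule topological_entropy_ge_ln[OF _ _ _ max_separated_standard_map_ge]) auto
  moreover have "ereal 0.44722970117798 \<le> ereal (ln 1.7)" using ln_1_7 by simp
  ultimately show ?thesis by (rule order_trans[rotated])
qed

end
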